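(* For every integer $k\geq 2$, each graph $G$ with minimum degree $\delta \geq 2k^2+1$ has a strong $\frac{1}{k}$-majority edge colouring with $k+1$ colours.
   Context: Graphs are finite and simple. Edge colourings are arbitrary maps from the edge set to a set of colours (not necessarily proper, and not all colours need be used). Two distinct edges are adjacent if they share an endpoint; thus an edge $e=uv$ is adjacent to exactly $d(u)+d(v)-2$ edges, where $d(\cdot)$ denotes degree. A strong $\frac{1}{k}$-majority edge colouring of $G$ is an edge colouring such that for every edge $e=uv$ and every colour $\alpha$, at most a $1/k$ fraction of the edges adjacent to $e$ have colour $\alpha$, i.e. at most $(d(u)+d(v)-2)/k$ edges adjacent to $e$ have colour $\alpha$. *)

theory Defs
  imports Complex_Main
begin

definition simple_graph :: "'a set \<Rightarrow> 'a set set \<Rightarrow> bool" where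
  "simple_graph V E \<longleftrightarrow> finite V \<and> (\<forall>e\<in>E. e \<subseteq> V \<and> card e = 2)"

definition degree :: "'a set set \<Rightarrow> 'a \<Rightarrow> nat" where
  "degree E v = card {e \<in> E. v \<in> e}"

(* Min {} is unspecified, so this is meaningful only for a nonempty vertex set. *)
definition min_degree :: "'a set \<Rightarrow> 'a set set \<Rightarrow> nat" where
  "min_degree V E = Min (degree E ` V)"

definition adjacent_edges :: "'a set set \<Rightarrow> 'a set \<Rightarrow> 'a set set" where
  "adjacent_edges E e = {f \<in> E. f \<noteq> e \<and> e \<inter> f \<noteq> {}}"

definition edge_colouring :: "'a set set \<Rightarrow> 'c set \<Rightarrow> ('a set \<Rightarrow> 'c) \<Rightarrow> bool" where
  "edge_colouring E C c \<longleftrightarrow> c ` E \<subseteq> C"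

definition strong_majority_edge_colouring ::
    "nat \<Rightarrow> 'a set set \<Rightarrow> 'c set \<Rightarrow> ('a set \<Rightarrow> 'c) \<Rightarrow> bool" where
  "strong_majority_edge_colouring k E C c \<longleftrightarrow>
     edge_colouring E C c \<and>
     (\<forall>e\<in>E. \<forall>\<alpha>\<in>C.
        real (card {f \<in> adjacent_edges E e. c f = \<alpha>}) \<le> real (card (adjacent_edges E e)) / real k)"

(* The bound above is (d(u) + d(v) - 2) / k; the natural subtraction does not truncate here,
   since both degrees count the edge {u, v}. *)
lemma card_adjacent_edges:
  assumes G: "simple_graph V E" and e: "{u, v} \<in> E"
  shows "card (adjacent_edges E {u, v}) = degree E u + degree E v - 2"
proof -
  have card2: "f \<subseteq> V" "card f = 2" if "f \<in> E" for f
    using G that by (auto simp: simple_graph_def)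
  have "E \<subseteq> Pow V" using card2(1) by blast
  then have fin: "finite E"
    using G by (meson finite_Pow_iff finite_subset simple_graph_def)
  have ne: "u \<noteq> v" using card2(2)[OF e] by auto
  let ?A = "\<lambda>x. {f \<in> E. x \<in> f} - {{u, v}}"
  have eq: "f = {u, v}" if "f \<in> E" "u \<in> f" "v \<in> f" for f
    using card2(2)[OF that(1)] that ne by (auto simp: card_2_iff)
  have "adjacent_edges E {u, v} = ?A u \<union> ?A v"
    by (auto simp: adjacent_edges_def)
  moreover have "?A u \<inter> ?A v = {}" using eq by blast
  ultimately have "card (adjacent_edges E {u, v}) = card (?A u) + card (?A v)"
    using fin by (simp add: card_Un_disjoint)
  moreover have "card (?A u) = degree E u - 1" "card (?A v) = degree E v - 1"
    using e by (simp_all add: degree_def)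
  moreover have "degree E u > 0" "degree E v > 0"
    using e fin by (auto simp: degree_def card_gt_0_iff)
  ultimately show ?thesis by linarith
qed

end

theory Submission
  imports Defs
begin

text \<open>
  Choose a colouring with \<open>k + 1\<close> colours that minimises the sum of the squares of all colour
  degrees. If at some vertex \<open>v\<close> colour \<open>\<alpha>\<close> occurred at least three times more often than \<open>\<beta>\<close>,
  then exchanging \<open>\<alpha>\<close> and \<open>\<beta>\<close> along a maximal alternating trail starting at \<open>v\<close> with an
  \<open>\<alpha>\<close>-edge would decrease this sum. So any two colour degrees at a vertex differ by at most \<open>2\<close>.
  If \<open>q = \<lfloor>(d(v) - 1) / k\<rfloor> \<ge> 2k\<close> and some colour had degree at least \<open>q + 1\<close> at \<open>v\<close>, all the
  others would have degree at least \<open>q - 1\<close>, hence \<open>(k + 1)(q - 1) + 2 \<le> d(v) \<le> qk + k\<close>, which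
  contradicts \<open>q \<ge> 2k\<close>. Adding \<open>d\<^sub>\<alpha>(v) \<le> (d(v) - 1) / k\<close> over the two ends of an edge gives the
  required bound.
\<close>

section \<open>Degrees in sets of edges\<close>

lemma degree_Un_disjoint:
  assumes "finite A" "finite B" "A \<inter> B = {}"
  shows "degree (A \<union> B) x = degree A x + degree B x"
proof -
  have "{e \<in> A \<union> B. x \<in> e} = {e \<in> A. x \<in> e} \<union> {e \<in> B. x \<in> e}" by blast
  then show ?thesis
    unfolding degree_def using assms by (simp add: card_Un_disjoint disjoint_iff)
qed

lemma degree_insert:
  assumes "finite A" "e \<notin> A"
  shows "degree (insert e A) x = degree A x + of_bool (x \<in> e)"
proof -
  have "degree {e} x = of_bool (x \<in> e)"
    by (cases "x \<in> e") (simp_all add: degree_def Collect_conv_if cong: conj_cong)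
  then show ?thesis
    using degree_Un_disjoint[of "{e}" A x] assms by simp
qed

lemma degree_mono:
  assumes "finite B" "A \<subseteq> B"
  shows "degree A x \<le> degree B x"
  unfolding degree_def using assms by (intro card_mono) auto

lemma degree_cong:
  assumes "\<And>e. x \<in> e \<Longrightarrow> e \<in> A \<longleftrightarrow> e \<in> B"
  shows "degree A x = degree B x"
  unfolding degree_def using assms by (metis (mono_tags, lifting))

section \<open>Alternating trails and exchanges\<close>

text \<open>For disjoint \<open>A\<close> and \<open>B\<close>, exchanging the classes of the edges
  in \<open>S\<close> lowers the \<open>A\<close>-degree of \<open>x\<close> by this number and
  raises its \<open>B\<close>-degree by the same number.\<close>

definition signed_degree :: "'a set set \<Rightarrow> 'a set set \<Rightarrow> 'a set set \<Rightarrow> 'a \<Rightarrow> int" where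
  "signed_degree A B S x = int (degree (S \<inter> A) x) - int (degree (S \<inter> B) x)"

text \<open>
  The edge set of a trail from \<open>v\<close> to \<open>w\<close> that alternates between \<open>A\<close> and \<open>B\<close>, beginning in \<open>A\<close>,
  has signed degree \<open>[x = v] + [x = w]\<close> if its last edge is in \<open>A\<close> and \<open>[x = v] - [x = w]\<close>
  if it is in \<open>B\<close>. Only this property is used, so the trail itself is never needed, and the empty
  set serves as the trail of length \<open>0\<close>.
\<close>

definition alternating :: "'a set set \<Rightarrow> 'a set set \<Rightarrow> 'a \<Rightarrow> 'a \<Rightarrow> int \<Rightarrow> 'a set set \<Rightarrow> bool" where
  "alternating A B v w \<epsilon> S \<longleftrightarrow> S \<subseteq> A \<union> B \<and>
     (\<forall>x. signed_degree A B S x = of_bool (x = v) + \<epsilon> * of_bool (x = w))"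

text \<open>The new edge contributes -\<epsilon> at both of its ends: at \<open>w\<close> this
  cancels the old end term, and at the other end it becomes the new one.\<close>

lemma alternating_extend:
  assumes "finite A" "finite B" "A \<inter> B = {}"
    and S: "alternating A B v w \<epsilon> S"
    and e: "e \<notin> S" "w \<in> e" "card e = 2"
    and \<epsilon>: "\<epsilon> = -1 \<and> e \<in> A \<or> \<epsilon> = 1 \<and> e \<in> B"
  shows "\<exists>w'. alternating A B v w' (-\<epsilon>) (insert e S)"
proof -
  obtain w' where w': "e = {w, w'}" "w \<noteq> w'"
    using e(2,3) by (auto simp: card_2_iff)
  have "finite S"
    using S assms(1,2) by (meson alternating_def finite_UnI finite_subset)
  have "signed_degree A B (insert e S) x = signed_degree A B S x - \<epsilon> * of_bool (x \<in> e)" for x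
    using \<epsilon> e(1) \<open>A \<inter> B = {}\<close> \<open>finite S\<close>
    by (auto simp: signed_degree_def Int_insert_left degree_insert)
  then have "alternating A B v w' (-\<epsilon>) (insert e S)"
    using S \<epsilon> w' by (auto simp: alternating_def)
  then show ?thesis ..
qed

text \<open>With s the signed degree and a, b the two degrees at x, the exchange turns a^2 + b^2
  into (a - s)^2 + (b + s)^2, a drop of 2 s (a - b - s). So no vertex gets worse and
  \<open>v\<close> improves.\<close>

lemma improving_exchange_set:
  assumes fin: "finite A" "finite B" and disj: "A \<inter> B = {}"
    and card2: "\<And>e. e \<in> A \<union> B \<Longrightarrow> card e = 2"
    and v: "degree A v > degree B v + 2"
  obtains S where "S \<subseteq> A \<union> B"
    and "\<And>x. signed_degree A B S x *
      (int (degree A x) - int (degree B x) - signed_degree A B S x) \<ge> of_bool (x = v)"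
proof -
  let ?F = "{S. \<exists>w \<epsilon>. \<epsilon> \<in> {1, -1} \<and> alternating A B v w \<epsilon> S}"
  have "?F \<subseteq> Pow (A \<union> B)" by (auto simp: alternating_def)
  then have "finite ?F" using fin by (meson finite_Pow_iff finite_UnI finite_subset)
  \<comment> \<open>With \<epsilon> = -1 the two terms at \<open>v\<close> cancel, and the first
    edge to be added must come from \<open>A\<close>.\<close>
  moreover have "alternating A B v v (-1) {}"
    by (simp add: alternating_def signed_degree_def)
  then have "?F \<noteq> {}" by blast
  ultimately obtain S where "S \<in> ?F" and max: "\<And>T. T \<in> ?F \<Longrightarrow> S \<subseteq> T \<Longrightarrow> T = S"
    using finite_has_maximal[of ?F] by (metis (no_types, lifting))
  then obtain w \<epsilon> where \<epsilon>: "\<epsilon> \<in> {1, -1}" and S: "alternating A B v w \<epsilon> S" by blast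
  have stuck: "e \<in> S" if e: "w \<in> e" "\<epsilon> = -1 \<and> e \<in> A \<or> \<epsilon> = 1 \<and> e \<in> B" for e
  proof (rule ccontr)
    assume "e \<notin> S"
    then obtain w' where "alternating A B v w' (-\<epsilon>) (insert e S)"
      using alternating_extend[OF fin disj S _ e(1) card2 e(2)] e(2) by blast
    then have "insert e S \<in> ?F" using \<epsilon> by force
    then show False using max \<open>e \<notin> S\<close> by blast
  qed
  let ?s = "signed_degree A B S" and ?d = "\<lambda>x. int (degree A x) - int (degree B x)"
  have s: "?s x = of_bool (x = v) + \<epsilon> * of_bool (x = w)" for x
    using S by (simp add: alternating_def)
  have le: "degree (S \<inter> A) w \<le> degree A w" "degree (S \<inter> B) w \<le> degree B w"
    using fin by (simp_all add: degree_mono)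
  \<comment> \<open>By maximality, the edges at \<open>w\<close> left outside \<open>S\<close>
    include none of \<open>B\<close> if \<epsilon> = 1 and none of \<open>A\<close> if \<epsilon> =
    -1. This fixes the sign of \<open>?d w - ?s w\<close>.\<close>
  have w: "if \<epsilon> = 1 then ?d w \<ge> ?s w else ?d w \<le> ?s w"
  proof (cases "\<epsilon> = 1")
    case True
    then have "degree (S \<inter> B) w = degree B w" using stuck by (intro degree_cong) blast
    then show ?thesis using True le by (simp add: signed_degree_def)
  next
    case False
    then have "degree (S \<inter> A) w = degree A w" using stuck \<epsilon> by (intro degree_cong) blast
    then show ?thesis using False le by (simp add: signed_degree_def)
  qed
  \<comment> \<open>The critical case is v = w. If \<epsilon> = 1, then \<open>?s v\<close> is 2 and
    a surplus of at least 3 keeps the product positive; if \<epsilon> = -1, fact \<open>w\<close>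
    would give \<open>?d v\<close> \<le> 0.\<close>
  have "?s x * (?d x - ?s x) \<ge> of_bool (x = v)" for x
    using w v \<epsilon> by (cases "x = v"; cases "x = w") (auto simp: s split: if_splits)
  then show thesis
    using S that by (auto simp: alternating_def)
qed

section \<open>Colourings of least energy\<close>

definition colour_class :: "'a set set \<Rightarrow> ('a set \<Rightarrow> 'c) \<Rightarrow> 'c \<Rightarrow> 'a set set" where
  "colour_class E c \<alpha> = {e \<in> E. c e = \<alpha>}"

definition energy :: "'a set \<Rightarrow> 'a set set \<Rightarrow> 'c set \<Rightarrow> ('a set \<Rightarrow> 'c) \<Rightarrow> nat" where
  "energy V E C c = (\<Sum>x\<in>V. \<Sum>\<gamma>\<in>C. (degree (colour_class E c \<gamma>) x)\<^sup>2)"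

lemma energy_decrease:
  assumes "finite V" "finite E" "finite C"
    and card2: "\<And>e. e \<in> E \<Longrightarrow> card e = 2"
    and c: "c ` E \<subseteq> C"
    and v: "v \<in> V" and \<alpha>\<beta>: "\<alpha> \<in> C" "\<beta> \<in> C"
    and big: "degree (colour_class E c \<alpha>) v > degree (colour_class E c \<beta>) v + 2"
  obtains c' where "c' ` E \<subseteq> C" "energy V E C c' < energy V E C c"
proof -
  define A where "A = colour_class E c \<alpha>"
  define B where "B = colour_class E c \<beta>"
  have "\<alpha> \<noteq> \<beta>" using big by auto
  have fin: "finite A" "finite B" using \<open>finite E\<close> by (simp_all add: A_def B_def colour_class_def)
  have disj: "A \<inter> B = {}" using \<open>\<alpha> \<noteq> \<beta>\<close> by (auto simp: A_def B_def colour_class_def)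
  have "card e = 2" if "e \<in> A \<union> B" for e
    using that card2 by (auto simp: A_def B_def colour_class_def)
  then obtain S where S: "S \<subseteq> A \<union> B"
    and gain: "\<And>x. signed_degree A B S x *
      (int (degree A x) - int (degree B x) - signed_degree A B S x) \<ge> of_bool (x = v)"
    using improving_exchange_set[OF fin disj] big by (metis A_def B_def)
  define c' where "c' = (\<lambda>e. if e \<in> S then if c e = \<alpha> then \<beta> else \<alpha> else c e)"
  define A' where "A' = colour_class E c' \<alpha>"
  define B' where "B' = colour_class E c' \<beta>"
  have A': "A' = (A - S) \<union> (S \<inter> B)" and B': "B' = (B - S) \<union> (S \<inter> A)"
    using S \<open>\<alpha> \<noteq> \<beta>\<close> by (auto simp: A'_def B'_def A_def B_def colour_class_def c'_def)
  have split: "degree X x = degree (X - S) x + degree (S \<inter> X) x" if "finite X" for X x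
  proof -
    have "X = (X - S) \<union> (S \<inter> X)" by blast
    moreover have "(X - S) \<inter> (S \<inter> X) = {}" by blast
    ultimately show ?thesis
      using degree_Un_disjoint[of "X - S" "S \<inter> X" x] that by simp
  qed
  have degA': "int (degree A' x) = int (degree A x) - signed_degree A B S x"
    and degB': "int (degree B' x) = int (degree B x) + signed_degree A B S x" for x
    unfolding A' B' signed_degree_def
    using fin disj split[OF fin(1), of x] split[OF fin(2), of x]
    by (auto simp: degree_Un_disjoint disjoint_iff)
  define R where "R x = (\<Sum>\<gamma>\<in>C - {\<alpha>, \<beta>}. (degree (colour_class E c \<gamma>) x)\<^sup>2)" for x
  have other: "colour_class E c' \<gamma> = colour_class E c \<gamma>" if "\<gamma> \<in> C - {\<alpha>, \<beta>}" for \<gamma>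
    using that S by (auto simp: c'_def A_def B_def colour_class_def)
  have sum_C: "(\<Sum>\<gamma>\<in>C. f \<gamma>) = f \<alpha> + f \<beta> + (\<Sum>\<gamma>\<in>C - {\<alpha>, \<beta>}. f \<gamma>)" for f :: "'b \<Rightarrow> nat"
  proof -
    have "C = insert \<alpha> (insert \<beta> (C - {\<alpha>, \<beta>}))" using \<alpha>\<beta> by blast
    then have "(\<Sum>\<gamma>\<in>C. f \<gamma>) = (\<Sum>\<gamma>\<in>insert \<alpha> (insert \<beta> (C - {\<alpha>, \<beta>})). f \<gamma>)" by simp
    also have "\<dots> = f \<alpha> + f \<beta> + (\<Sum>\<gamma>\<in>C - {\<alpha>, \<beta>}. f \<gamma>)"
      using \<open>finite C\<close> \<open>\<alpha> \<noteq> \<beta>\<close> by simp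
    finally show ?thesis .
  qed
  have E1: "energy V E C c = (\<Sum>x\<in>V. (degree A x)\<^sup>2 + (degree B x)\<^sup>2 + R x)"
    by (simp add: energy_def sum_C A_def B_def R_def)
  have E2: "energy V E C c' = (\<Sum>x\<in>V. (degree A' x)\<^sup>2 + (degree B' x)\<^sup>2 + R x)"
    by (simp add: energy_def sum_C A'_def B'_def R_def other)
  have step: "(degree A' x)\<^sup>2 + (degree B' x)\<^sup>2 + of_bool (x = v)
      \<le> (degree A x)\<^sup>2 + (degree B x)\<^sup>2" for x
  proof -
    let ?a = "int (degree A x)" and ?b = "int (degree B x)" and ?s = "signed_degree A B S x"
    have "(int (degree A' x))\<^sup>2 + (int (degree B' x))\<^sup>2 + 2 * (?s * (?a - ?b - ?s)) = ?a\<^sup>2 + ?b\<^sup>2"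
      unfolding degA' degB' by (simp add: power2_eq_square algebra_simps)
    then have "(int (degree A' x))\<^sup>2 + (int (degree B' x))\<^sup>2 + of_bool (x = v) \<le> ?a\<^sup>2 + ?b\<^sup>2"
      using gain[of x] by (cases "x = v") simp_all
    then have "int ((degree A' x)\<^sup>2 + (degree B' x)\<^sup>2 + of_bool (x = v))
      \<le> int ((degree A x)\<^sup>2 + (degree B x)\<^sup>2)" by simp
    then show ?thesis by linarith
  qed
  have "energy V E C c' < energy V E C c"
    unfolding E1 E2
  proof (rule sum_strict_mono_ex1)
    show "\<forall>x\<in>V. (degree A' x)\<^sup>2 + (degree B' x)\<^sup>2 + R x \<le> (degree A x)\<^sup>2 + (degree B x)\<^sup>2 + R x"
      using step by (meson add_le_mono1 add_leD1)
    show "\<exists>x\<in>V. (degree A' x)\<^sup>2 + (degree B' x)\<^sup>2 + R x < (degree A x)\<^sup>2 + (degree B x)\<^sup>2 + R x"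
      using v step[of v] by (intro bexI[of _ v]) auto
  qed (fact \<open>finite V\<close>)
  moreover have "c' ` E \<subseteq> C" using c \<alpha>\<beta> by (auto simp: c'_def)
  ultimately show thesis using that by blast
qed

lemma ex_balanced_edge_colouring:
  assumes "finite V" "finite E" "finite C" "C \<noteq> {}"
    and "\<And>e. e \<in> E \<Longrightarrow> card e = 2"
  obtains c where "c ` E \<subseteq> C"
    and "\<And>v \<alpha> \<beta>. v \<in> V \<Longrightarrow> \<alpha> \<in> C \<Longrightarrow> \<beta> \<in> C \<Longrightarrow>
      degree (colour_class E c \<alpha>) v \<le> degree (colour_class E c \<beta>) v + 2"
proof -
  \<comment> \<open>A constant colouring shows that candidates exist; the least energy is attained
    because energies are natural numbers.\<close>
  obtain \<gamma> where "\<gamma> \<in> C" using \<open>C \<noteq> {}\<close> by blast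
  then have "(\<lambda>_. \<gamma>) ` E \<subseteq> C" by blast
  then obtain c where c: "c ` E \<subseteq> C"
    and min: "\<And>c'. c' ` E \<subseteq> C \<Longrightarrow> energy V E C c \<le> energy V E C c'"
    using ex_has_least_nat[of "\<lambda>c. c ` E \<subseteq> C" "\<lambda>_. \<gamma>" "energy V E C"] by blast
  show thesis
  proof (rule that[OF c], rule ccontr)
    fix v \<alpha> \<beta>
    assume "v \<in> V" "\<alpha> \<in> C" "\<beta> \<in> C"
      and "\<not> degree (colour_class E c \<alpha>) v \<le> degree (colour_class E c \<beta>) v + 2"
    then obtain c' where "c' ` E \<subseteq> C" "energy V E C c' < energy V E C c"
      using energy_decrease[OF assms(1-3,5) c, of v \<alpha> \<beta>] by auto
    then show False using min[of c'] by simp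
  qed
qed

section \<open>From balanced colour degrees to the majority bound\<close>

lemma sum_degree_colour_class:
  assumes "finite E" "finite C" "c ` E \<subseteq> C"
  shows "(\<Sum>\<alpha>\<in>C. degree (colour_class E c \<alpha>) v) = degree E v"
proof -
  have "(\<Sum>\<alpha>\<in>C. \<Sum>e\<in>{e \<in> {e \<in> E. v \<in> e}. c e = \<alpha>}. 1) = (\<Sum>e\<in>{e \<in> E. v \<in> e}. 1::nat)"
    using assms by (intro sum.group) auto
  then show ?thesis
    by (simp add: degree_def colour_class_def conj_ac)
qed

lemma balanced_max_bound:
  fixes d :: "'c \<Rightarrow> nat" and k n :: nat
  assumes "finite C" "card C = k + 1" "k > 0"
    and sum: "(\<Sum>\<alpha>\<in>C. d \<alpha>) = n" and n: "n \<ge> 2 * k\<^sup>2 + 1"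
    and balanced: "\<And>\<alpha> \<beta>. \<alpha> \<in> C \<Longrightarrow> \<beta> \<in> C \<Longrightarrow> d \<alpha> \<le> d \<beta> + 2"
    and \<alpha>: "\<alpha> \<in> C"
  shows "k * d \<alpha> \<le> n - 1"
proof -
  \<comment> \<open>The largest integer with k q \<le> n - 1, so the claim amounts to
    \<open>d \<alpha> \<le> q\<close>.\<close>
  define q where "q = (n - 1) div k"
  have "2 * k \<le> q"
    using div_le_mono[of "k * (2 * k)" "n - 1" k] n \<open>k > 0\<close>
    by (simp add: q_def power2_eq_square)
  have "n - 1 < k * q + k"
    using dividend_less_times_div[OF \<open>k > 0\<close>, of "n - 1"] by (simp add: q_def)
  have "d \<alpha> \<le> q"
  proof (rule ccontr)
    assume "\<not> d \<alpha> \<le> q"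
    then have "q + 1 \<le> d \<alpha>" by simp
    have "k * (q - 1) = (\<Sum>\<beta>\<in>C - {\<alpha>}. q - 1)"
      using \<alpha> \<open>card C = k + 1\<close> \<open>finite C\<close> by simp
    also have "\<dots> \<le> (\<Sum>\<beta>\<in>C - {\<alpha>}. d \<beta>)"
      using balanced[OF \<alpha>] \<open>q + 1 \<le> d \<alpha>\<close> by (intro sum_mono) fastforce
    \<comment> \<open>Together with n \<le> k q + k this forces q + 1 \<le> 2 k.\<close>
    finally have "q + 1 + k * (q - 1) \<le> n"
      using \<open>q + 1 \<le> d \<alpha>\<close> sum sum.remove[OF \<open>finite C\<close> \<alpha>, of d] by simp
    moreover have "k * (q - 1) + k = k * q"
      using \<open>2 * k \<le> q\<close> \<open>k > 0\<close> by (cases q) simp_all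
    ultimately show False
      using \<open>2 * k \<le> q\<close> \<open>n - 1 < k * q + k\<close> by linarith
  qed
  then have "k * d \<alpha> \<le> k * q" by simp
  also have "\<dots> \<le> n - 1" by (simp add: q_def)
  finally show ?thesis .
qed

theorem theorem7:
  fixes k :: nat and V :: "'a set" and E :: "'a set set"
  assumes "k \<ge> 2"
    and "simple_graph V E"
    and "min_degree V E \<ge> 2 * k\<^sup>2 + 1"
  shows "\<exists>c :: 'a set \<Rightarrow> nat. strong_majority_edge_colouring k E {1..k + 1} c"
proof -
  have "finite V" and E: "\<And>e. e \<in> E \<Longrightarrow> e \<subseteq> V" "\<And>e. e \<in> E \<Longrightarrow> card e = 2"
    using assms(2) by (auto simp: simple_graph_def)
  then have "finite E" by (meson PowI finite_Pow_iff finite_subset subsetI)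
  let ?C = "{1..k + 1}"
  obtain c where c: "c ` E \<subseteq> ?C"
    and balanced: "\<And>v \<alpha> \<beta>. v \<in> V \<Longrightarrow> \<alpha> \<in> ?C \<Longrightarrow> \<beta> \<in> ?C \<Longrightarrow>
      degree (colour_class E c \<alpha>) v \<le> degree (colour_class E c \<beta>) v + 2"
    by (rule ex_balanced_edge_colouring[OF \<open>finite V\<close> \<open>finite E\<close>, of ?C]) (use E in auto)
  have deg: "2 * k\<^sup>2 + 1 \<le> degree E v" if "v \<in> V" for v
    using that \<open>finite V\<close> assms(3) by (auto simp: min_degree_def intro: order_trans Min_le)
  have bound: "k * degree (colour_class E c \<alpha>) v \<le> degree E v - 1"
    if "v \<in> V" "\<alpha> \<in> ?C" for v \<alpha>
    using assms(1) that balanced deg sum_degree_colour_class[OF \<open>finite E\<close> _ c]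
    by (intro balanced_max_bound[of ?C]) auto
  have "real (card {f \<in> adjacent_edges E e. c f = \<alpha>}) \<le> real (card (adjacent_edges E e)) / real k"
    if "e \<in> E" "\<alpha> \<in> ?C" for e \<alpha>
  proof -
    obtain u v where e: "e = {u, v}"
      using E(2)[OF \<open>e \<in> E\<close>] by (auto simp: card_2_iff)
    then have uv: "u \<in> V" "v \<in> V" using E(1)[OF \<open>e \<in> E\<close>] by auto
    let ?A = "colour_class E c \<alpha>"
    \<comment> \<open>The right side may also contain \<open>e\<close> itself, which is harmless for
      an upper bound.\<close>
    have "{f \<in> adjacent_edges E e. c f = \<alpha>} \<subseteq> {f \<in> ?A. u \<in> f} \<union> {f \<in> ?A. v \<in> f}"
      by (auto simp: adjacent_edges_def colour_class_def e)
    then have "card {f \<in> adjacent_edges E e. c f = \<alpha>} \<le> card ({f \<in> ?A. u \<in> f} \<union> {f \<in> ?A. v \<in> f})"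
      using \<open>finite E\<close> by (intro card_mono) (auto simp: colour_class_def)
    also have "\<dots> \<le> degree ?A u + degree ?A v"
      unfolding degree_def by (rule card_Un_le)
    finally have "k * card {f \<in> adjacent_edges E e. c f = \<alpha>} \<le> k * degree ?A u + k * degree ?A v"
      by (metis add_mult_distrib2 mult_le_mono2)
    \<comment> \<open>The -1 in \<open>bound\<close> at each end adds up to the -2 in the number of
      adjacent edges.\<close>
    also have "\<dots> \<le> card (adjacent_edges E e)"
      using bound[OF uv(1) \<open>\<alpha> \<in> ?C\<close>] bound[OF uv(2) \<open>\<alpha> \<in> ?C\<close>] deg[OF uv(1)] deg[OF uv(2)]
        card_adjacent_edges[OF assms(2), of u v] \<open>e \<in> E\<close> e by simp
    finally have "real k * real (card {f \<in> adjacent_edges E e. c f = \<alpha>})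
        \<le> real (card (adjacent_edges E e))"
      by (metis of_nat_le_iff of_nat_mult)
    then show ?thesis
      using assms(1) by (simp add: field_simps)
  qed
  with c show ?thesis
    unfolding strong_majority_edge_colouring_def edge_colouring_def by blast
qed

end
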